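(* Suppose $\{(G_i,\Sigma_i)\}_{i\ge1}$ is an infinite sequence of finite groups $G_i$ with generating sets $\Sigma_i\subset G_i$. For each $n$ let $S_n$ be the set of generators of $H_n=G_1\times\cdots\times G_n$ obtained as the union, over $1\le i\le n$, of the sets $\{1\}\times\cdots\times\{1\}\times\Sigma_i\times\{1\}\times\cdots\times\{1\}$ (with $\Sigma_i$ in the $i$th slot). If all $G_i$ are non-trivial, then the sequence of Cayley graphs of $(H_n,S_n)$ is an expander light sequence.
   Context: A graph sequence is a sequence of finite connected undirected graphs whose numbers of vertices tend to infinity. Vertex sets carry the graph metric. The Cayley graph of $(H,S)$ is the undirected graph with vertex set $H$ in which distinct $g,h$ are joined by an edge if $h=gs$ or $g=hs$ for some $s\in S$. For a subset $A$ of (the vertices of) a finite graph $G$, $\operatorname{halo}(A)$ is the set of vertices not in $A$ whose (open) $2$-ball in the graph metric intersects $A$, i.e. vertices outside $A$ adjacent to a vertex of $A$. A graph sequence $\{\Gamma_n\}$ is an expander light sequence if there is $c>0$ such that for any uniformly bounded sequence of subsets $A_n\subset\Gamma_n$ (i.e. the diameters of the $A_n$ in the graph metrics of the $\Gamma_n$ are bounded by a common finite constant) one has $|\operatorname{halo}(A_n)|\ge c\cdot|A_n|$ for infinitely many $n$. *)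

theory Defs
  imports
    "HOL-Algebra.Product_Groups"
    "HOL-Algebra.Generated_Groups"
    "Graph_Theory.Pair_Digraph"
    "Graph_Theory.Digraph_Component"
    "Graph_Theory.Shortest_Path"
begin

text \<open>
  A finite simple undirected graph is a \<^emph>\<open>pair_graph\<close> (a finite, symmetric, loop-free digraph).
  Sequences of groups, graphs and vertex sets are indexed by the integers \<open>n \<ge> 1\<close>;
  the value of such a function at \<open>0\<close> is never constrained.
\<close>

text \<open>The graph metric: the least number of edges of a walk from \<open>u\<close> to \<open>v\<close>
  (\<open>\<infinity>\<close> if there is none).\<close>

definition graph_dist :: "'a pair_pre_digraph \<Rightarrow> 'a \<Rightarrow> 'a \<Rightarrow> ereal" where
  "graph_dist \<Gamma> u v = wf_digraph.\<mu> (with_proj \<Gamma>) (\<lambda>_. 1) u v"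

definition graph_ball :: "'a pair_pre_digraph \<Rightarrow> 'a \<Rightarrow> ereal \<Rightarrow> 'a set" where
  "graph_ball \<Gamma> v r = {u \<in> pverts \<Gamma>. graph_dist \<Gamma> v u < r}"

text \<open>Distances are those of the ambient graph \<open>\<Gamma>\<close>, not of the subgraph induced on \<open>A\<close>.
  The diameter of the empty set is \<open>-\<infinity>\<close>, so the empty set counts as bounded.\<close>

definition graph_diam :: "'a pair_pre_digraph \<Rightarrow> 'a set \<Rightarrow> ereal" where
  "graph_diam \<Gamma> A = (SUP u\<in>A. SUP v\<in>A. graph_dist \<Gamma> u v)"

definition halo :: "'a pair_pre_digraph \<Rightarrow> 'a set \<Rightarrow> 'a set" where
  "halo \<Gamma> A = {v \<in> pverts \<Gamma> - A. graph_ball \<Gamma> v 2 \<inter> A \<noteq> {}}"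

definition graph_sequence :: "(nat \<Rightarrow> 'a pair_pre_digraph) \<Rightarrow> bool" where
  "graph_sequence \<Gamma> \<longleftrightarrow>
     (\<forall>n\<ge>1. pair_graph (\<Gamma> n) \<and> Digraph_Component.connected (with_proj (\<Gamma> n))) \<and>
     filterlim (\<lambda>n. card (pverts (\<Gamma> n))) at_top sequentially"

definition uniformly_bounded_subsets ::
    "(nat \<Rightarrow> 'a pair_pre_digraph) \<Rightarrow> (nat \<Rightarrow> 'a set) \<Rightarrow> bool" where
  "uniformly_bounded_subsets \<Gamma> A \<longleftrightarrow>
     (\<forall>n\<ge>1. A n \<subseteq> pverts (\<Gamma> n)) \<and>
     (\<exists>D::real. \<forall>n\<ge>1. graph_diam (\<Gamma> n) (A n) \<le> ereal D)"

definition expander_light :: "(nat \<Rightarrow> 'a pair_pre_digraph) \<Rightarrow> bool" where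
  "expander_light \<Gamma> \<longleftrightarrow>
     graph_sequence \<Gamma> \<and>
     (\<exists>c::real. c > 0 \<and>
        (\<forall>A. uniformly_bounded_subsets \<Gamma> A \<longrightarrow>
           infinite {n. n \<ge> 1 \<and> real (card (halo (\<Gamma> n) (A n))) \<ge> c * real (card (A n))}))"

definition cayley_graph :: "('a, 'b) monoid_scheme \<Rightarrow> 'a set \<Rightarrow> 'a pair_pre_digraph" where
  "cayley_graph H S =
     \<lparr> pverts = carrier H,
       parcs = {(g, h). g \<in> carrier H \<and> h \<in> carrier H \<and> g \<noteq> h \<and>
                  (\<exists>s\<in>S. h = g \<otimes>\<^bsub>H\<^esub> s \<or> g = h \<otimes>\<^bsub>H\<^esub> s)} \<rparr>"

text \<open>The union over the slots \<open>i\<close> of the sets \<open>{1} \<times> \<dots> \<times> \<Sigma> i \<times> \<dots> \<times> {1}\<close>, inside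
  \<open>product_group {1..n} G\<close>.\<close>

definition product_generators ::
    "(nat \<Rightarrow> ('a, 'b) monoid_scheme) \<Rightarrow> (nat \<Rightarrow> 'a set) \<Rightarrow> nat \<Rightarrow> (nat \<Rightarrow> 'a) set" where
  "product_generators G \<Sigma> n =
     (\<Union>i\<in>{1..n}. \<Pi>\<^sub>E j\<in>{1..n}. if j = i then \<Sigma> j else {\<one>\<^bsub>G j\<^esub>})"

end

theory Submission
  imports Defs
begin

text \<open>
  Cayley distance in \<open>H\<^sub>n\<close> dominates Hamming distance, so a set \<open>A\<close> of diameter at most \<open>D\<close>
  lies in a Hamming ball of radius \<open>D\<close> about some \<open>x\<^sub>0\<close>. For each \<open>a \<in> A\<close> and each of the at least
  \<open>n - D\<close> coordinates \<open>i\<close> with \<open>a i = x\<^sub>0 i\<close>, multiply \<open>a\<close> in slot \<open>i\<close> by a nontrivial generator.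
  A point so obtained differs from \<open>x\<^sub>0\<close> in at most \<open>D + 1\<close> coordinates, \<open>i\<close> is among them, and
  \<open>i\<close> determines \<open>a\<close>; hence there are at least \<open>(n - D) |A| / (D + 1)\<close> such points, all
  in \<open>A\<close> or its halo. For \<open>n \<ge> 3 D + 2\<close> this gives \<open>|halo(A)| \<ge> |A|\<close>, so \<open>c = 1\<close> works.
\<close>

section \<open>Distances in pair graphs\<close>

lemma graph_dist_arc_le_1:
  assumes "pair_wf_digraph \<Gamma>" "(u, v) \<in> parcs \<Gamma>"
  shows "graph_dist \<Gamma> u v \<le> 1"
proof -
  interpret pair_wf_digraph \<Gamma> by fact
  have "awalk u [(u, v)] v"
    using assms(2) arc_fst_in_verts[OF assms(2)] by (simp add: awalk_def)
  from min_cost_le_walk_cost[OF this, of "\<lambda>_. 1"] show ?thesis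
    by (simp add: graph_dist_def one_ereal_def)
qed

text \<open>Each arc lowers \<open>d\<close> to a fixed target by at most one, so every walk has
  length at least \<open>d u v\<close>, and the infimum over walks inherits the bound.\<close>

lemma le_graph_distI:
  assumes "pair_wf_digraph \<Gamma>"
    and refl: "\<And>u. d u u = 0"
    and step: "\<And>u v w. (u, v) \<in> parcs \<Gamma> \<Longrightarrow> d u w \<le> Suc (d v w)"
  shows "ereal (real (d u v)) \<le> graph_dist \<Gamma> u v"
proof -
  interpret pair_wf_digraph \<Gamma> by fact
  have "d u v \<le> length p" if "set p \<subseteq> parcs \<Gamma>" "pcas u p v" for p
    using that
  proof (induction p arbitrary: u)
    case (Cons e p)
    then show ?case
      using step[of u "snd e" v] by (cases e) force
  qed (simp add: refl)
  moreover have "awalk_cost (\<lambda>_. 1) p = real (length p)" for p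
    by (induction p) auto
  ultimately show ?thesis
    unfolding graph_dist_def \<mu>_def by (intro INF_greatest) (auto simp: awalk_def)
qed

lemma graph_dist_le_graph_diam:
  "u \<in> A \<Longrightarrow> v \<in> A \<Longrightarrow> graph_dist \<Gamma> u v \<le> graph_diam \<Gamma> A"
  unfolding graph_diam_def by (meson SUP_upper SUP_upper2)

lemma in_haloI:
  assumes "pair_graph \<Gamma>" "(a, v) \<in> parcs \<Gamma>" "a \<in> A" "v \<notin> A"
  shows "v \<in> halo \<Gamma> A"
proof -
  interpret pair_graph \<Gamma> by fact
  \<comment> \<open>The ball in \<open>halo\<close> is centred at the outer vertex \<open>v\<close>,
    so the arc is needed in the reverse direction.\<close>
  have "(v, a) \<in> parcs \<Gamma>"
    using assms(2) arcs_symmetric by blast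
  then have "graph_dist \<Gamma> v a \<le> 1"
    by (intro graph_dist_arc_le_1) unfold_locales
  also have "(1::ereal) < 2" by simp
  finally have "graph_dist \<Gamma> v a < 2" .
  with assms(2-4) show ?thesis
    by (force simp: halo_def graph_ball_def dest: arc_fst_in_verts arc_snd_in_verts)
qed

section \<open>Hamming distance\<close>

definition hamming :: "'i set \<Rightarrow> ('i \<Rightarrow> 'a) \<Rightarrow> ('i \<Rightarrow> 'a) \<Rightarrow> nat" where
  "hamming I u v = card {i \<in> I. u i \<noteq> v i}"

lemma hamming_refl [simp]: "hamming I u u = 0"
  by (simp add: hamming_def)

lemma hamming_upd_le:
  assumes "finite I"
  shows "hamming I (u(i := s)) w \<le> Suc (hamming I u w)"
proof -
  have "{j \<in> I. (u(i := s)) j \<noteq> w j} \<subseteq> insert i {j \<in> I. u j \<noteq> w j}"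
    by auto
  then have "card {j \<in> I. (u(i := s)) j \<noteq> w j} \<le> card (insert i {j \<in> I. u j \<noteq> w j})"
    using assms by (intro card_mono) auto
  also have "\<dots> \<le> Suc (card {j \<in> I. u j \<noteq> w j})"
    by (rule card_insert_le_m1) simp_all
  finally show ?thesis
    by (simp add: hamming_def)
qed

text \<open>Double counting of the pairs in \<open>P\<close>: each \<open>a\<close> occurs in at
  least \<open>card I - D\<close> of them, and each fibre of \<open>f\<close> has at most
  \<open>Suc D\<close> elements.\<close>

lemma card_hamming_shifts:
  fixes A :: "('i \<Rightarrow> 'a) set"
  assumes "finite I" "finite A"
    and t: "\<And>i. i \<in> I \<Longrightarrow> t i \<noteq> x0 i"
    and D: "\<And>a. a \<in> A \<Longrightarrow> hamming I a x0 \<le> D"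
  shows "(card I - D) * card A
           \<le> Suc D * card {a(i := t i) |a i. a \<in> A \<and> i \<in> I \<and> a i = x0 i}"
proof -
  define P where "P = (SIGMA a:A. {i \<in> I. a i = x0 i})"
  define f where "f = (\<lambda>(a, i). a(i := t i))"
  have "finite P"
    using assms by (auto simp: P_def)
  have agree: "card I - D \<le> card {i \<in> I. a i = x0 i}" if "a \<in> A" for a
  proof -
    have "{i \<in> I. a i = x0 i} = I - {i \<in> I. a i \<noteq> x0 i}"
      by auto
    then have "card {i \<in> I. a i = x0 i} = card I - hamming I a x0"
      using \<open>finite I\<close> by (simp add: card_Diff_subset hamming_def)
    then show ?thesis
      using D[OF that] by simp
  qed
  have fibre: "card {p \<in> P. f p = b} \<le> Suc D" if "b \<in> f ` P" for b
  proof -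
    have inj: "inj_on snd {p \<in> P. f p = b}"
    proof (rule inj_onI)
      fix p q assume p: "p \<in> {p \<in> P. f p = b}" and q: "q \<in> {p \<in> P. f p = b}"
        and eq: "snd p = snd q"
      \<comment> \<open>Resetting slot \<open>i\<close> of \<open>b\<close> to \<open>x0 i\<close>
        recovers \<open>a\<close>, because pairs in \<open>P\<close> satisfy
        \<open>a i = x0 i\<close>.\<close>
      have "fst r = b(snd r := x0 (snd r))" if "r \<in> {p \<in> P. f p = b}" for r
        using that by (auto simp: P_def f_def)
      from this[OF p] this[OF q] eq show "p = q"
        by (simp add: prod_eq_iff)
    qed
    \<comment> \<open>The modified slot is a disagreement with \<open>x0\<close>: there
      \<open>b i = t i\<close>, which differs from \<open>x0 i\<close>.\<close>
    have "snd ` {p \<in> P. f p = b} \<subseteq> {i \<in> I. b i \<noteq> x0 i}"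
      using t by (auto simp: P_def f_def)
    then have "card {p \<in> P. f p = b} \<le> hamming I b x0"
      unfolding hamming_def using inj \<open>finite I\<close> by (intro card_inj_on_le) auto
    also have "hamming I b x0 \<le> Suc D"
    proof -
      from \<open>b \<in> f ` P\<close> obtain a i where "a \<in> A" "b = a(i := t i)"
        by (auto simp: P_def f_def)
      then show ?thesis
        using hamming_upd_le[OF \<open>finite I\<close>, of a i "t i" x0] D[of a] by simp
    qed
    finally show ?thesis .
  qed
  have "(card I - D) * card A \<le> (\<Sum>a\<in>A. card {i \<in> I. a i = x0 i})"
    using sum_bounded_below[of A "card I - D", OF agree] by (simp add: mult.commute)
  also have "\<dots> = card P"
    using assms by (simp add: P_def)
  also have "\<dots> = (\<Sum>b\<in>f ` P. card {p \<in> P. f p = b})"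
    using sum.image_gen[OF \<open>finite P\<close>, of "\<lambda>_. 1::nat" f] by simp
  also have "\<dots> \<le> Suc D * card (f ` P)"
    using sum_bounded_above[of "f ` P" _ "Suc D", OF fibre] by (simp add: mult.commute)
  also have "f ` P = {a(i := t i) |a i. a \<in> A \<and> i \<in> I \<and> a i = x0 i}"
    by (force simp: P_def f_def)
  finally show ?thesis .
qed

section \<open>Cayley graphs of products of finite groups\<close>

lemma pair_graph_cayley_graph:
  assumes "finite (carrier H)"
  shows "pair_graph (cayley_graph H S)"
proof
  have "parcs (cayley_graph H S) \<subseteq> carrier H \<times> carrier H"
    by (auto simp: cayley_graph_def)
  then show "finite (parcs (cayley_graph H S))"
    using assms by (meson finite_SigmaI finite_subset)
  show "symmetric (with_proj (cayley_graph H S))"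
    unfolding symmetric_def by (auto simp: cayley_graph_def sym_def)
qed (use assms in \<open>auto simp: cayley_graph_def\<close>)

locale generated_group_family =
  fixes G :: "nat \<Rightarrow> ('a, 'b) monoid_scheme" and \<Sigma> :: "nat \<Rightarrow> 'a set"
  assumes group_G: "\<And>i. i \<ge> 1 \<Longrightarrow> group (G i)"
    and finite_G: "\<And>i. i \<ge> 1 \<Longrightarrow> finite (carrier (G i))"
    and gens_sub: "\<And>i. i \<ge> 1 \<Longrightarrow> \<Sigma> i \<subseteq> carrier (G i)"
    and gens_generate: "\<And>i. i \<ge> 1 \<Longrightarrow> generate (G i) (\<Sigma> i) = carrier (G i)"
    and nontrivial: "\<And>i. i \<ge> 1 \<Longrightarrow> \<not> trivial_group (G i)"
begin

declare One_nat_def [simp del]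

abbreviation vertices :: "nat \<Rightarrow> (nat \<Rightarrow> 'a) set" where
  "vertices n \<equiv> \<Pi>\<^sub>E i\<in>{1..n}. carrier (G i)"

abbreviation \<Gamma> :: "nat \<Rightarrow> (nat \<Rightarrow> 'a) pair_pre_digraph" where
  "\<Gamma> n \<equiv> cayley_graph (product_group {1..n} G) (product_generators G \<Sigma> n)"

lemma pverts_\<Gamma> [simp]: "pverts (\<Gamma> n) = vertices n"
  by (simp add: cayley_graph_def)

lemma finite_vertices: "finite (vertices n)"
  using finite_G by (intro finite_PiE) auto

lemma pair_graph_\<Gamma>: "pair_graph (\<Gamma> n)"
  using finite_vertices by (intro pair_graph_cayley_graph) simp

lemma mult_single_slot:
  assumes "x \<in> vertices n" "i \<in> {1..n}"
    and "t \<in> (\<Pi>\<^sub>E j\<in>{1..n}. if j = i then \<Sigma> j else {\<one>\<^bsub>G j\<^esub>})"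
  shows "x \<otimes>\<^bsub>product_group {1..n} G\<^esub> t = x(i := x i \<otimes>\<^bsub>G i\<^esub> t i)"
proof
  fix j
  show "(x \<otimes>\<^bsub>product_group {1..n} G\<^esub> t) j = (x(i := x i \<otimes>\<^bsub>G i\<^esub> t i)) j"
  proof (cases "j \<in> {1..n}")
    case True
    interpret group "G j"
      using True by (intro group_G) simp
    have "x j \<in> carrier (G j)" "j \<noteq> i \<Longrightarrow> t j = \<one>\<^bsub>G j\<^esub>"
      using PiE_mem[OF assms(1) True] PiE_mem[OF assms(3) True] by simp_all
    then show ?thesis
      using True by (cases "j = i") simp_all
  next
    case False
    then have "j \<noteq> i"
      using assms(2) by blast
    \<comment> \<open>Outside the index range both sides take the default value
      \<open>undefined\<close>.\<close>
    then show ?thesis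
      using False PiE_arb[OF assms(1) False] by (simp del: atLeastAtMost_iff)
  qed
qed

text \<open>The last hypothesis rules out a loop, since Cayley graphs join only distinct
  vertices.\<close>

lemma arc_single_slot:
  assumes "x \<in> vertices n" "i \<in> {1..n}" "s \<in> \<Sigma> i" "x i \<otimes>\<^bsub>G i\<^esub> s \<noteq> x i"
  shows "(x, x(i := x i \<otimes>\<^bsub>G i\<^esub> s)) \<in> parcs (\<Gamma> n)"
proof -
  define t where "t = (\<lambda>j\<in>{1..n}. if j = i then s else \<one>\<^bsub>G j\<^esub>)"
  have t: "t \<in> (\<Pi>\<^sub>E j\<in>{1..n}. if j = i then \<Sigma> j else {\<one>\<^bsub>G j\<^esub>})"
    using assms by (auto simp: t_def)
  have "x \<otimes>\<^bsub>product_group {1..n} G\<^esub> t = x(i := x i \<otimes>\<^bsub>G i\<^esub> s)"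
    using mult_single_slot[OF assms(1,2) t] assms(2) by (simp add: t_def)
  moreover have "x i \<otimes>\<^bsub>G i\<^esub> s \<in> carrier (G i)"
    using assms gens_sub[of i] group.is_monoid[OF group_G, of i]
    by (intro monoid.m_closed) auto
  then have "x(i := x i \<otimes>\<^bsub>G i\<^esub> s) \<in> vertices n"
    using assms(1,2) by (auto simp: PiE_iff extensional_def)
  moreover have "t \<in> product_generators G \<Sigma> n"
    unfolding product_generators_def using t assms(2) by blast
  moreover have "x \<noteq> x(i := x i \<otimes>\<^bsub>G i\<^esub> s)"
    using assms(4) by (metis fun_upd_same)
  ultimately show ?thesis
    using assms(1) unfolding cayley_graph_def by (auto intro!: bexI[of _ t])
qed

lemma arc_imp_upd:
  assumes "(x, y) \<in> parcs (\<Gamma> n)"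
  obtains i s where "x = y(i := s)"
proof -
  have xy: "x \<in> vertices n" "y \<in> vertices n"
    and "\<exists>t\<in>product_generators G \<Sigma> n.
      y = x \<otimes>\<^bsub>product_group {1..n} G\<^esub> t \<or> x = y \<otimes>\<^bsub>product_group {1..n} G\<^esub> t"
    using assms unfolding cayley_graph_def by simp_all
  then obtain t i where i: "i \<in> {1..n}"
    and t: "t \<in> (\<Pi>\<^sub>E j\<in>{1..n}. if j = i then \<Sigma> j else {\<one>\<^bsub>G j\<^esub>})"
    and "y = x \<otimes>\<^bsub>product_group {1..n} G\<^esub> t \<or> x = y \<otimes>\<^bsub>product_group {1..n} G\<^esub> t"
    unfolding product_generators_def by blast
  then have "y = x(i := x i \<otimes>\<^bsub>G i\<^esub> t i) \<or> x = y(i := y i \<otimes>\<^bsub>G i\<^esub> t i)"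
    by (simp only: mult_single_slot[OF xy(1) i t] mult_single_slot[OF xy(2) i t])
  \<comment> \<open>Whichever endpoint carries the generator, \<open>x\<close> and \<open>y\<close>
    agree off slot \<open>i\<close>.\<close>
  then have "x = y(i := x i)"
    by (metis fun_upd_same fun_upd_triv fun_upd_upd)
  then show ?thesis
    by (rule that)
qed

text \<open>An arc alters a single coordinate, so it changes the Hamming distance to any fixed point
  by at most one.\<close>

lemma hamming_le_graph_dist: "ereal (real (hamming {1..n} u v)) \<le> graph_dist (\<Gamma> n) u v"
proof (rule le_graph_distI)
  interpret pair_graph "\<Gamma> n" by (rule pair_graph_\<Gamma>)
  show "pair_wf_digraph (\<Gamma> n)" by unfold_locales
  show "hamming {1..n} x z \<le> Suc (hamming {1..n} y z)" if "(x, y) \<in> parcs (\<Gamma> n)" for x y z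
    using that by (auto elim!: arc_imp_upd intro: hamming_upd_le)
qed simp

text \<open>Generators all equal to the identity would generate only the trivial subgroup. This is
  where nontriviality of the factors enters.\<close>

lemma ex_nontrivial_generator:
  assumes "i \<ge> 1"
  obtains s where "s \<in> \<Sigma> i" "s \<noteq> \<one>\<^bsub>G i\<^esub>"
proof -
  interpret group "G i" by (rule group_G[OF assms])
  have False if "\<Sigma> i \<subseteq> {\<one>\<^bsub>G i\<^esub>}"
  proof -
    have "carrier (G i) \<subseteq> {\<one>\<^bsub>G i\<^esub>}"
      using mono_generate[OF that] gens_generate[OF assms] generate_one by simp
    then have "trivial_group (G i)"
      using group_G[OF assms] by (auto simp: trivial_group_def)
    with nontrivial[OF assms] show False by simp
  qed
  with that show ?thesis by blast
qed

lemma card_le_card_halo: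
  assumes A: "A \<subseteq> vertices n" and diam: "graph_diam (\<Gamma> n) A \<le> ereal (real D)"
    and n: "n \<ge> 3 * D + 2"
  shows "card A \<le> card (halo (\<Gamma> n) A)"
proof (cases "A = {}")
  case False
  then obtain x0 where x0: "x0 \<in> A" by blast
  have "\<forall>i\<in>{1..n}. \<exists>s. s \<in> \<Sigma> i \<and> s \<noteq> \<one>\<^bsub>G i\<^esub>"
    by (meson atLeastAtMost_iff ex_nontrivial_generator)
  then obtain s where s: "s i \<in> \<Sigma> i" "s i \<noteq> \<one>\<^bsub>G i\<^esub>" if "i \<in> {1..n}" for i
    by metis
  \<comment> \<open>Multiplying by \<open>s i\<close> at slot \<open>i\<close> gives this same value
    for every \<open>a\<close> with \<open>a i = x0 i\<close>, so it depends on \<open>i\<close>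
    alone.\<close>
  define t where "t i = x0 i \<otimes>\<^bsub>G i\<^esub> s i" for i
  have t: "t i \<noteq> x0 i" if i: "i \<in> {1..n}" for i
  proof -
    interpret group "G i" using group_G i by simp
    have "s i \<in> carrier (G i)" "x0 i \<in> carrier (G i)"
      using s(1)[OF i] gens_sub[of i] i PiE_mem[OF subsetD[OF A x0] i] by auto
    then show ?thesis
      using s(2)[OF i] by (simp add: t_def r_cancel_one)
  qed
  have finA: "finite A"
    using A finite_vertices finite_subset by blast
  have D: "hamming {1..n} a x0 \<le> D" if "a \<in> A" for a
  proof -
    have "ereal (real (hamming {1..n} a x0)) \<le> ereal (real D)"
      using hamming_le_graph_dist graph_dist_le_graph_diam[OF that x0] diam
      by (meson order_trans)
    then show ?thesis by simp
  qed
  define B where "B = {a(i := t i) |a i. a \<in> A \<and> i \<in> {1..n} \<and> a i = x0 i}"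
  \<comment> \<open>The threshold \<open>3 * D + 2\<close> is exactly what makes
    \<open>n - D\<close> at least \<open>2 * Suc D\<close>.\<close>
  have "2 * Suc D * card A \<le> (card {1..n} - D) * card A"
    using n by (intro mult_right_mono) auto
  also have "\<dots> \<le> Suc D * card B"
    unfolding B_def by (rule card_hamming_shifts) (use finA t D in auto)
  finally have "2 * card A \<le> card B"
    by (metis Suc_mult_le_cancel1 mult.assoc mult.left_commute)
  \<comment> \<open>Of the at least \<open>2 * card A\<close> points of \<open>B\<close>, at most
    \<open>card A\<close> lie in \<open>A\<close>; the rest must be in the halo.\<close>
  also have "B \<subseteq> A \<union> halo (\<Gamma> n) A"
  proof
    fix b assume "b \<in> B"
    then obtain a i where a: "a \<in> A" "i \<in> {1..n}" "a i = x0 i" "b = a(i := t i)"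
      by (auto simp: B_def)
    then have "(a, b) \<in> parcs (\<Gamma> n)"
      using arc_single_slot[of a n i "s i"] A s t[of i] by (auto simp: t_def)
    with a show "b \<in> A \<union> halo (\<Gamma> n) A"
      using in_haloI[OF pair_graph_\<Gamma>] by blast
  qed
  then have "card B \<le> card (A \<union> halo (\<Gamma> n) A)"
    using finA finite_vertices by (intro card_mono) (auto simp: halo_def)
  also have "\<dots> \<le> card A + card (halo (\<Gamma> n) A)"
    by (rule card_Un_le)
  finally show ?thesis by simp
qed simp

section \<open>Connectedness of the product Cayley graphs\<close>

lemma reachable_slot:
  assumes i: "i \<in> {1..n}" and g: "g \<in> carrier (G i)" and x: "x \<in> vertices n"
  shows "x \<rightarrow>\<^sup>*\<^bsub>with_proj (\<Gamma> n)\<^esub> x(i := x i \<otimes>\<^bsub>G i\<^esub> g)"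
proof -
  interpret pair_graph "\<Gamma> n" by (rule pair_graph_\<Gamma>)
  interpret Gi: group "G i" using group_G i by simp
  have upd: "x(i := h) \<in> vertices n" if "x \<in> vertices n" "h \<in> carrier (G i)" for x h
    using that i by (auto simp: PiE_iff extensional_def)
  have carr: "x i \<in> carrier (G i)" if "x \<in> vertices n" for x
    using that i by auto
  have gen: "x \<rightarrow>\<^sup>*\<^bsub>with_proj (\<Gamma> n)\<^esub> x(i := x i \<otimes>\<^bsub>G i\<^esub> s)"
    if x: "x \<in> vertices n" and s: "s \<in> \<Sigma> i" for x s
  proof (cases "x i \<otimes>\<^bsub>G i\<^esub> s = x i")
    \<comment> \<open>Here the generator gives no arc, and the empty walk suffices.\<close>
    case True
    then show ?thesis using x by simp
  next
    case False
    then show ?thesis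
      using arc_single_slot[OF x i s] by blast
  qed
  \<comment> \<open>Induction on how \<open>g\<close> is generated, with \<open>x\<close> arbitrary:
    for a product, the second walk starts where the first ends.\<close>
  have "g \<in> generate (G i) (\<Sigma> i)"
    using g gens_generate i by simp
  then show ?thesis
    using x
  proof (induction arbitrary: x)
    case one
    then show ?case using carr[of x] by simp
  next
    case (incl s)
    then show ?case by (intro gen)
  next
    case (inv s)
    then have s: "s \<in> carrier (G i)" using gens_sub[of i] i by auto
    \<comment> \<open>The generator \<open>s\<close> leads from \<open>y\<close> back to
      \<open>x\<close>; symmetry of the graph reverses this walk.\<close>
    define y where "y = x(i := x i \<otimes>\<^bsub>G i\<^esub> inv\<^bsub>G i\<^esub> s)"
    have y: "y \<in> vertices n"
      unfolding y_def using inv s carr by (intro upd) auto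
    have "x = y(i := y i \<otimes>\<^bsub>G i\<^esub> s)"
      using s carr[OF inv(2)] by (simp add: y_def Gi.m_assoc)
    then have "y \<rightarrow>\<^sup>*\<^bsub>with_proj (\<Gamma> n)\<^esub> x"
      using gen[OF y inv(1)] by simp
    then show ?case
      unfolding y_def by (rule symmetric_reachable[OF sym_arcs])
  next
    case (eng h k)
    have hk: "h \<in> carrier (G i)" "k \<in> carrier (G i)"
      using eng(1,2) gens_generate[of i] i by auto
    define y where "y = x(i := x i \<otimes>\<^bsub>G i\<^esub> h)"
    have y: "y \<in> vertices n"
      unfolding y_def using eng.prems hk carr by (intro upd) auto
    have "x \<rightarrow>\<^sup>*\<^bsub>with_proj (\<Gamma> n)\<^esub> y"
      unfolding y_def by (rule eng.IH(1)) (rule eng.prems)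
    also have "y \<rightarrow>\<^sup>*\<^bsub>with_proj (\<Gamma> n)\<^esub> y(i := y i \<otimes>\<^bsub>G i\<^esub> k)"
      by (rule eng.IH(2)) (rule y)
    also have "y(i := y i \<otimes>\<^bsub>G i\<^esub> k) = x(i := x i \<otimes>\<^bsub>G i\<^esub> (h \<otimes>\<^bsub>G i\<^esub> k))"
      using hk carr[OF eng.prems] by (simp add: y_def Gi.m_assoc)
    finally show ?case .
  qed
qed

lemma reachable_\<Gamma>:
  assumes x: "x \<in> vertices n" and y: "y \<in> vertices n"
  shows "x \<rightarrow>\<^sup>*\<^bsub>with_proj (\<Gamma> n)\<^esub> y"
proof -
  interpret pair_graph "\<Gamma> n" by (rule pair_graph_\<Gamma>)
  \<comment> \<open>Interpolation from \<open>x\<close> to \<open>y\<close>: \<open>z k\<close>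
    already has the coordinates of \<open>y\<close> up to \<open>k\<close>, so consecutive points
    differ at most in slot \<open>Suc k\<close>.\<close>
  define z where "z k j = (if j \<le> k then y j else x j)" for k j
  have z: "z k \<in> vertices n" for k
    using x y by (auto simp: z_def PiE_iff extensional_def)
  have "x \<rightarrow>\<^sup>*\<^bsub>with_proj (\<Gamma> n)\<^esub> z k" if "k \<le> n" for k
    using that
  proof (induction k)
    case 0
    \<comment> \<open>Index 0 lies outside \<open>{1..n}\<close>, where \<open>x\<close> and
      \<open>y\<close> are both \<open>undefined\<close>.\<close>
    have "z 0 = x"
      using PiE_arb[OF x, of 0] PiE_arb[OF y, of 0] by (auto simp: z_def)
    then show ?case using x by simp
  next
    case (Suc k)
    interpret Gk: group "G (Suc k)" by (rule group_G) simp
    \<comment> \<open>Slot \<open>Suc k\<close> of \<open>z k\<close> still holds the value of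
      \<open>x\<close>, and right multiplication by \<open>g\<close> turns it into that of
      \<open>y\<close>.\<close>
    define g where "g = inv\<^bsub>G (Suc k)\<^esub> x (Suc k) \<otimes>\<^bsub>G (Suc k)\<^esub> y (Suc k)"
    have carr: "x (Suc k) \<in> carrier (G (Suc k))" "y (Suc k) \<in> carrier (G (Suc k))"
      using x y Suc.prems by auto
    have "g \<in> carrier (G (Suc k))"
      using carr by (simp add: g_def)
    moreover have "y (Suc k) = z k (Suc k) \<otimes>\<^bsub>G (Suc k)\<^esub> g"
      using carr by (simp add: z_def g_def Gk.m_assoc[symmetric])
    then have "(z k)(Suc k := z k (Suc k) \<otimes>\<^bsub>G (Suc k)\<^esub> g) = z (Suc k)"
      by (auto simp: z_def fun_eq_iff le_Suc_eq)
    ultimately have "z k \<rightarrow>\<^sup>*\<^bsub>with_proj (\<Gamma> n)\<^esub> z (Suc k)"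
      using reachable_slot[of "Suc k" n g "z k"] Suc.prems z by simp
    with Suc show ?case
      using reachable_trans by (meson Suc_leD)
  qed
  from this[of n] have "x \<rightarrow>\<^sup>*\<^bsub>with_proj (\<Gamma> n)\<^esub> z n" by simp
  moreover have "z n = y"
    using PiE_arb[OF x] PiE_arb[OF y] by (force simp: z_def)
  ultimately show ?thesis by simp
qed

section \<open>Growth of the vertex sets and conclusion\<close>

lemma two_le_card:
  assumes "i \<ge> 1"
  shows "2 \<le> card (carrier (G i))"
proof -
  interpret group "G i" by (rule group_G[OF assms])
  obtain s where "s \<in> \<Sigma> i" "s \<noteq> \<one>\<^bsub>G i\<^esub>"
    by (rule ex_nontrivial_generator[OF assms])
  then have "card {\<one>\<^bsub>G i\<^esub>, s} = 2" "{\<one>\<^bsub>G i\<^esub>, s} \<subseteq> carrier (G i)"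
    using gens_sub[OF assms] by auto
  then show ?thesis
    by (metis card_mono finite_G[OF assms])
qed

text \<open>Each of the \<open>n\<close> factors has at least two elements, so there are at least
  \<open>2 ^ n\<close> vertices.\<close>

lemma le_card_vertices: "n \<le> card (vertices n)"
proof -
  have "n \<le> 2 ^ n"
    by (rule less_imp_le) (rule less_exp)
  also have "\<dots> = (\<Prod>i\<in>{1..n}. 2)" by simp
  also have "\<dots> \<le> (\<Prod>i\<in>{1..n}. card (carrier (G i)))"
    by (rule prod_mono) (use two_le_card in auto)
  finally show ?thesis
    by (simp add: card_PiE)
qed

lemma graph_sequence_\<Gamma>: "graph_sequence \<Gamma>"
  unfolding graph_sequence_def
proof (intro conjI allI impI)
  show "filterlim (\<lambda>n. card (pverts (\<Gamma> n))) at_top sequentially"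
    unfolding pverts_\<Gamma>
    by (rule filterlim_at_top_mono[OF filterlim_ident]) (simp add: le_card_vertices)
next
  fix n :: nat assume "n \<ge> 1"
  show "pair_graph (\<Gamma> n)" by (rule pair_graph_\<Gamma>)
  then interpret pair_graph "\<Gamma> n" .
  have "vertices n \<noteq> {}"
    using le_card_vertices[of n] \<open>n \<ge> 1\<close> by auto
  then show "Digraph_Component.connected (with_proj (\<Gamma> n))"
    unfolding Digraph_Component.connected_def
    by (auto simp: reachable_\<Gamma> intro!: strongly_connectedI reachable_mk_symmetricI)
qed

lemma expander_light_\<Gamma>: "expander_light \<Gamma>"
  unfolding expander_light_def
proof (intro conjI exI[of _ "1::real"] allI impI)
  fix A assume "uniformly_bounded_subsets \<Gamma> A"
  then obtain D where A: "A n \<subseteq> vertices n" "graph_diam (\<Gamma> n) (A n) \<le> ereal D" if "n \<ge> 1" for n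
    unfolding uniformly_bounded_subsets_def pverts_\<Gamma> by blast
  \<comment> \<open>The real bound \<open>D\<close> may be fractional or negative; it is replaced by
    a natural number above it.\<close>
  define d where "d = nat \<lceil>D\<rceil>"
  have "D \<le> real d" by (simp add: d_def real_nat_ceiling_ge)
  have "card (A n) \<le> card (halo (\<Gamma> n) (A n))" if "n \<ge> 3 * d + 2" for n
    using that A[of n] \<open>D \<le> real d\<close>
    by (intro card_le_card_halo[of _ _ d]) (auto intro: order_trans)
  \<comment> \<open>The halo inequality holds for all large \<open>n\<close>, which is more than
    infinitely often.\<close>
  then have "{3 * d + 2..} \<subseteq> {n. 1 \<le> n \<and>
      1 * real (card (A n)) \<le> real (card (halo (\<Gamma> n) (A n)))}"
    by auto
  then show "infinite {n. 1 \<le> n \<and>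
      1 * real (card (A n)) \<le> real (card (halo (\<Gamma> n) (A n)))}"
    using infinite_Ici infinite_super by blast
qed (use graph_sequence_\<Gamma> in auto)

end

theorem proposition7p13:
  fixes G :: "nat \<Rightarrow> ('a, 'b) monoid_scheme"
    and \<Sigma> :: "nat \<Rightarrow> 'a set"
  assumes "\<And>i. i \<ge> 1 \<Longrightarrow> group (G i)"
    and "\<And>i. i \<ge> 1 \<Longrightarrow> finite (carrier (G i))"
    and "\<And>i. i \<ge> 1 \<Longrightarrow> \<Sigma> i \<subseteq> carrier (G i)"
    and "\<And>i. i \<ge> 1 \<Longrightarrow> generate (G i) (\<Sigma> i) = carrier (G i)"
    and "\<And>i. i \<ge> 1 \<Longrightarrow> \<not> trivial_group (G i)"
  shows "expander_light (\<lambda>n. cayley_graph (product_group {1..n} G) (product_generators G \<Sigma> n))"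
proof -
  interpret generated_group_family G \<Sigma>
    using assms by (rule generated_group_family.intro)
  show ?thesis
    by (rule expander_light_\<Gamma>)
qed

end
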